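(* In the online circuit switch scheduling problem without switching delay, the online greedy algorithm described below is $\frac12$-competitive: for every $T\geq1$ and every input sequence of bipartite multigraphs $E_1,\ldots,E_T$, if $M_1,\ldots,M_T$ are the matchings chosen by the algorithm and $O_1,\ldots,O_T$ is an optimal (offline) feasible sequence of matchings, then $\sum_{t=1}^T|M_t|\geq\frac12\sum_{t=1}^T|O_t|$.
   Context: Let $A,B$ be finite disjoint sets. The input is a sequence of bipartite multigraphs on $A\cup B$ given by edge multisets $E_1,\ldots,E_T$ (each edge copy is one unit of demand), where $E_t$ is revealed at the beginning of step $t$; unions of multisets add multiplicities. At each step $t$ an algorithm chooses a matching $M_t$ (a set of pairwise vertex-disjoint edges) consisting of edge copies that have been revealed at steps $1,\ldots,t$ and were not used by $M_1,\ldots,M_{t-1}$; each used edge copy is removed. The objective is $\sum_{t=1}^T|M_t|$. An online algorithm chooses $M_t$ knowing only $E_1,\ldots,E_t$; the optimum $O_1,\ldots,O_T$ is a sequence of matchings satisfying the same rules and maximizing $\sum_t|O_t|$, chosen with full knowledge of the input. Online greedy algorithm: $R_0=\emptyset$; for $t=1,\ldots,T$: $R'_t=R_{t-1}\cup E_t$, $M_t$ is a maximum-cardinality matching contained in $R'_t$, and $R_t=R'_t\setminus M_t$. *)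

theory Defs
  imports Complex_Main "HOL-Library.Multiset"
begin

text \<open>
  An edge is the set of its two endpoints, so two edges are vertex-disjoint iff they are disjoint
  as sets. A multigraph is a multiset of edges. Parallel copies of an edge are never
  vertex-disjoint, hence a matching is a set of edges; it uses one copy of each of its edges,
  that is, the multiset \<open>mset_set M\<close>.
\<close>

type_synonym 'v edge = "'v set"

definition bipartite_edges :: "'v set \<Rightarrow> 'v set \<Rightarrow> 'v edge set" where
  "bipartite_edges A B = {{a, b} | a b. a \<in> A \<and> b \<in> B}"

definition matching_in :: "'v edge multiset \<Rightarrow> 'v edge set \<Rightarrow> bool" where
  "matching_in R M \<longleftrightarrow> M \<subseteq> set_mset R \<and> pairwise disjnt M"

definition maximum_matching_in :: "'v edge multiset \<Rightarrow> 'v edge set \<Rightarrow> bool" where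
  "maximum_matching_in R M \<longleftrightarrow>
     matching_in R M \<and> (\<forall>N. matching_in R N \<longrightarrow> card N \<le> card M)"

text \<open>
  Steps are numbered from 1; values of \<open>E\<close> and \<open>M\<close> outside \<open>{1..T}\<close> are irrelevant.
  Since each earlier matching is itself drawn from the available copies, the truncating multiset
  difference below never truncates for a feasible sequence.
\<close>

definition available :: "(nat \<Rightarrow> 'v edge multiset) \<Rightarrow> (nat \<Rightarrow> 'v edge set) \<Rightarrow> nat \<Rightarrow> 'v edge multiset" where
  "available E M t = (\<Sum>s\<in>{1..t}. E s) - (\<Sum>s\<in>{1..<t}. mset_set (M s))"

definition feasible :: "(nat \<Rightarrow> 'v edge multiset) \<Rightarrow> nat \<Rightarrow> (nat \<Rightarrow> 'v edge set) \<Rightarrow> bool" where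
  "feasible E T M \<longleftrightarrow> (\<forall>t\<in>{1..T}. matching_in (available E M t) (M t))"

definition objective :: "nat \<Rightarrow> (nat \<Rightarrow> 'v edge set) \<Rightarrow> nat" where
  "objective T M = (\<Sum>t=1..T. card (M t))"

definition optimal :: "(nat \<Rightarrow> 'v edge multiset) \<Rightarrow> nat \<Rightarrow> (nat \<Rightarrow> 'v edge set) \<Rightarrow> bool" where
  "optimal E T M \<longleftrightarrow>
     feasible E T M \<and> (\<forall>N. feasible E T N \<longrightarrow> objective T N \<le> objective T M)"

primrec residual :: "(nat \<Rightarrow> 'v edge multiset) \<Rightarrow> (nat \<Rightarrow> 'v edge set) \<Rightarrow> nat \<Rightarrow> 'v edge multiset" where
  "residual E M 0 = {#}"
| "residual E M (Suc t) = residual E M t + E (Suc t) - mset_set (M (Suc t))"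

text \<open>
  The algorithm may break ties between maximum matchings arbitrarily, so its possible outputs on
  input \<open>E\<close> form a predicate on sequences of matchings.
\<close>

definition greedy_run :: "(nat \<Rightarrow> 'v edge multiset) \<Rightarrow> nat \<Rightarrow> (nat \<Rightarrow> 'v edge set) \<Rightarrow> bool" where
  "greedy_run E T M \<longleftrightarrow>
     (\<forall>t\<in>{1..T}. maximum_matching_in (residual E M (t - 1) + E t) (M t))"

lemma greedy_run_residual:
  assumes "greedy_run E T M" "t \<le> T"
  shows "residual E M t + (\<Sum>s\<in>{1..t}. mset_set (M s)) = (\<Sum>s\<in>{1..t}. E s)"
  using assms(2)
proof (induction t)
  case 0
  show ?case by simp
next
  case (Suc t)
  let ?R = "residual E M t + E (Suc t)"
  have "maximum_matching_in ?R (M (Suc t))"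
    using assms(1) Suc.prems unfolding greedy_run_def by force
  then have "M (Suc t) \<subseteq> set_mset ?R"
    by (simp add: maximum_matching_in_def matching_in_def)
  then have "mset_set (M (Suc t)) \<subseteq># mset_set (set_mset ?R)"
    by (intro subset_imp_msubset_mset_set) auto
  also have "\<dots> \<subseteq># ?R"
    by (rule mset_set_set_mset_msubset)
  finally have "residual E M (Suc t) + mset_set (M (Suc t)) = ?R"
    by simp
  moreover have "residual E M t + (\<Sum>s\<in>{1..t}. mset_set (M s)) = (\<Sum>s\<in>{1..t}. E s)"
    using Suc by simp
  ultimately show ?case
    by (simp del: residual.simps add: ac_simps) (metis add.assoc add.commute)
qed

lemma greedy_run_feasible:
  assumes "greedy_run E T M"
  shows "feasible E T M"
  unfolding feasible_def
proof
  fix t assume t: "t \<in> {1..T}"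
  then obtain u where u: "t = Suc u" "u \<le> T" by (cases t) auto
  have "available E M t = residual E M (t - 1) + E t"
    using greedy_run_residual[OF assms u(2), symmetric]
    by (simp add: available_def u atLeastLessThanSuc_atLeastAtMost)
  then show "matching_in (available E M t) (M t)"
    using assms t by (simp add: greedy_run_def maximum_matching_in_def)
qed

end

theory Submission
  imports Defs
begin

text \<open>
  Charge each edge served by the optimum at step \<open>t\<close> to the greedy algorithm. The edges that are
  still available to the greedy algorithm at step \<open>t\<close> form a matching there, so there are at most
  \<open>card (M t)\<close> of them. An edge that is no longer available has all its revealed copies already
  used by the greedy algorithm; the last such step for a fixed edge \<open>e\<close> shows that the optimum
  uses \<open>e\<close> in this way at most as often as the greedy algorithm uses \<open>e\<close> altogether. Each of the
  two kinds hence contributes at most the greedy objective.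
\<close>

lemma matching_in_mset_subset:
  assumes "matching_in R M"
  shows "mset_set M \<subseteq># R"
proof -
  have "mset_set M \<subseteq># mset_set (set_mset R)"
    using assms by (intro subset_imp_msubset_mset_set) (auto simp: matching_in_def)
  also have "\<dots> \<subseteq># R"
    by (rule mset_set_set_mset_msubset)
  finally show ?thesis .
qed

lemma matching_in_finite: "matching_in R M \<Longrightarrow> finite M"
  by (auto simp: matching_in_def intro: finite_subset)

text \<open>The multiset difference in \<open>available\<close> truncates, so drawing from it
  respects the supply only if the earlier matchings already do. The induction carries this
  along.\<close>

lemma feasible_sum_subset:
  assumes "feasible E T N" "n \<le> T"
  shows "(\<Sum>t\<in>{1..n}. mset_set (N t)) \<subseteq># (\<Sum>t\<in>{1..n}. E t)"
  using assms(2)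
proof (induction n)
  case 0
  show ?case by simp
next
  case (Suc n)
  let ?U = "\<Sum>t\<in>{1..n}. mset_set (N t)" and ?F = "\<Sum>t\<in>{1..Suc n}. E t"
  have "matching_in (available E N (Suc n)) (N (Suc n))"
    using assms(1) Suc.prems by (simp add: feasible_def)
  then have new: "mset_set (N (Suc n)) \<subseteq># ?F - ?U"
    using matching_in_mset_subset
    unfolding available_def atLeastLessThanSuc_atLeastAtMost by blast
  have "?U \<subseteq># (\<Sum>t\<in>{1..n}. E t)"
    using Suc by simp
  then have "?U \<subseteq># ?F"
    by (simp add: subset_mset.add_increasing2)
  then have "?U + mset_set (N (Suc n)) \<subseteq># ?F"
    using new by (simp only: subset_mset.le_diff_conv2 add.commute)
  then show ?case
    by simp
qed

text \<open>The last such step of an edge is never picked explicitly. In the induction, either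
  \<open>e\<close> is exhausted at the new step and counting copies settles it afresh, or the left
  count of \<open>e\<close> does not grow and the induction hypothesis suffices.\<close>

lemma greedy_run_exhausted_subset:
  assumes greedy: "greedy_run E T M" and feas: "feasible E T N" and "n \<le> T"
  shows "(\<Sum>t\<in>{1..n}. mset_set (N t - set_mset (residual E M (t - 1) + E t)))
           \<subseteq># (\<Sum>t\<in>{1..n}. mset_set (M t))"
  using assms(3)
proof (induction n)
  case 0
  show ?case by simp
next
  case (Suc n)
  define D where "D t = N t - set_mset (residual E M (t - 1) + E t)" for t
  let ?DS = "\<lambda>n. \<Sum>t\<in>{1..n}. mset_set (D t)" and ?MS = "\<lambda>n. \<Sum>t\<in>{1..n}. mset_set (M t)"
  have IH: "?DS n \<subseteq># ?MS n"
    using Suc by (simp add: D_def)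
  have "count (?DS (Suc n)) e \<le> count (?MS (Suc n)) e" for e
  proof (cases "e \<in> D (Suc n)")
    case True
    have fin: "finite (N t)" if "t \<in> {1..T}" for t
      using feas that matching_in_finite unfolding feasible_def by blast
    have "?DS (Suc n) \<subseteq># (\<Sum>t\<in>{1..Suc n}. mset_set (N t))"
    proof (rule mset_subset_eqI, unfold count_sum, rule sum_mono)
      fix e t assume "t \<in> {1..Suc n}"
      then have "mset_set (D t) \<subseteq># mset_set (N t)"
        using Suc.prems fin by (intro subset_imp_msubset_mset_set) (auto simp: D_def)
      then show "count (mset_set (D t)) e \<le> count (mset_set (N t)) e"
        by (rule mset_subset_eq_count)
    qed
    also have "\<dots> \<subseteq># (\<Sum>t\<in>{1..Suc n}. E t)"
      by (rule feasible_sum_subset[OF feas Suc.prems])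
    \<comment> \<open>Every copy revealed so far is either in the greedy pool just before the choice
      of \<open>M (Suc n)\<close> or was used in the first \<open>n\<close> steps.\<close>
    also have "\<dots> = residual E M n + E (Suc n) + ?MS n"
      using greedy_run_residual[OF greedy, of n] Suc.prems by (simp add: ac_simps)
    finally have "count (?DS (Suc n)) e \<le> count (residual E M n + E (Suc n) + ?MS n) e"
      by (rule mset_subset_eq_count)
    \<comment> \<open>The pool holds no copy of \<open>e\<close>, so greedy used all revealed copies
      before step \<open>Suc n\<close>.\<close>
    also have "\<dots> = count (?MS n) e"
      using True by (simp add: D_def not_in_iff)
    also have "\<dots> \<le> count (?MS (Suc n)) e"
      by simp
    finally show ?thesis .
  next
    case False
    then have "count (mset_set (D (Suc n))) e = 0"
      by (metis count_mset_set(3))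
    then show ?thesis
      using mset_subset_eq_count[OF IH, of e] by simp
  qed
  then have "?DS (Suc n) \<subseteq># ?MS (Suc n)"
    by (rule mset_subset_eqI)
  then show ?case
    by (simp only: D_def)
qed

theorem greedy_run_half_competitive:
  assumes greedy: "greedy_run E T M" and feas: "feasible E T N"
  shows "objective T N \<le> 2 * objective T M"
proof -
  let ?R = "\<lambda>t. set_mset (residual E M (t - 1) + E t)"
  have N: "matching_in (available E N t) (N t)" if "t \<in> {1..T}" for t
    using feas that by (simp add: feasible_def)
  have "objective T N = (\<Sum>t=1..T. card (N t \<inter> ?R t) + card (N t - ?R t))"
    unfolding objective_def
    by (intro sum.cong refl, rule card_Int_Diff) (blast intro: N matching_in_finite)
  \<comment> \<open>Available edges are bounded step by step, exhausted ones only in total.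
    Gathering the latter in one multiset lets a multiset inclusion bound their number.\<close>
  also have "\<dots> = (\<Sum>t=1..T. card (N t \<inter> ?R t)) + size (\<Sum>t\<in>{1..T}. mset_set (N t - ?R t))"
    by (simp add: sum.distrib)
  also have "\<dots> \<le> objective T M + size (\<Sum>t\<in>{1..T}. mset_set (M t))"
  proof (rule add_mono)
    have "card (N t \<inter> ?R t) \<le> card (M t)" if "t \<in> {1..T}" for t
    proof -
      have "matching_in (residual E M (t - 1) + E t) (N t \<inter> ?R t)"
        using N[OF that] by (auto simp: matching_in_def intro: pairwise_subset)
      then show ?thesis
        using greedy that unfolding greedy_run_def maximum_matching_in_def by blast
    qed
    then show "(\<Sum>t=1..T. card (N t \<inter> ?R t)) \<le> objective T M"
      unfolding objective_def by (rule sum_mono)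
    show "size (\<Sum>t\<in>{1..T}. mset_set (N t - ?R t)) \<le> size (\<Sum>t\<in>{1..T}. mset_set (M t))"
      by (rule size_mset_mono[OF greedy_run_exhausted_subset[OF greedy feas order_refl]])
  qed
  also have "\<dots> = 2 * objective T M"
    by (simp add: objective_def)
  finally show ?thesis .
qed

theorem theorem6:
  fixes A B :: "'v set"
    and E :: "nat \<Rightarrow> 'v edge multiset"
    and M Opt :: "nat \<Rightarrow> 'v edge set"
    and T :: nat
  assumes "finite A" and "finite B" and "A \<inter> B = {}"
    and "T \<ge> 1"
    and "\<And>t. t \<in> {1..T} \<Longrightarrow> set_mset (E t) \<subseteq> bipartite_edges A B"
    and "greedy_run E T M"
    and "optimal E T Opt"
  shows "real (\<Sum>t=1..T. card (M t)) \<ge> 1 / 2 * real (\<Sum>t=1..T. card (Opt t))"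
proof -
  have "objective T Opt \<le> 2 * objective T M"
    using greedy_run_half_competitive assms(6,7) unfolding optimal_def by blast
  then have "real (objective T Opt) \<le> 2 * real (objective T M)"
    by linarith
  then show ?thesis
    unfolding objective_def by linarith
qed

end
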